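(* The interior product $\imath_{C_2}C_1\in\mathcal{C}^{n+m-2}(E)$ (defined in the context) is equivalently given by $$\imath_{C_2}C_1(e_1,\dots,e_{n+m-3})=\sum_{k=m-1}^{n+m-3}\ \sum_{\tau\in Sh(k-(m-1),m-2)}\mathrm{sgn}(\tau)(-1)^{mk}\,C_1\big(e_{\tau(1)},\dots,e_{\tau(k-(m-1))},C_2(e_{\tau(k-(m-2))},\dots,e_{\tau(k-1)},e_k),e_{k+1},\dots,e_{n+m-3}\big),$$ with $C_1\in\mathcal{C}^n(E)$ and $C_2\in\mathcal{C}^m(E)$, $m\ge1$.
   Context: Setting. $E\to M$ is a vector bundle equipped with a fibrewise non-degenerate symmetric bilinear form $\langle\cdot,\cdot\rangle$; $\Gamma(E)$ is its space of sections and $\mathfrak{X}(M)$ is the space of vector fields on $M$. $\mathrm{sgn}(\tau)$ is the sign of a permutation $\tau$, and $Sh(i,j)$ is the set of $(i,j)$-unshuffles, i.e. permutations $\tau$ of $i+j$ elements with $\tau(1)<\dots<\tau(i)$ and $\tau(i+1)<\dots<\tau(i+j)$. A hat denotes omission. Pre-Courant structures. An $n$-ary pre-Courant structure on $(E,\langle\cdot,\cdot\rangle)$ is a multilinear $n$-bracket $C:\Gamma(E)\times\stackrel{(n)}{\ldots}\times\Gamma(E)\to\Gamma(E)$, $n\ge0$, for which there exists a map $\sigma_C:\Gamma(E)\times\stackrel{(n-1)}{\ldots}\times\Gamma(E)\to\mathfrak{X}(M)$, called the symbol of $C$, such that for all sections of $E$: (a) $\sigma_C(e_1,\dots,e_{n-1})\cdot\langle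 e,e'\rangle=\langle C(e_1,\dots,e_{n-1},e),e'\rangle+\langle e,C(e_1,\dots,e_{n-1},e')\rangle$; (b) for $n\ge2$ and $1\le i\le n-1$: $\langle C(e_1,\dots,e_i,e_{i+1},\dots,e_n)+C(e_1,\dots,e_{i+1},e_i,\dots,e_n),e\rangle=\sigma_C(e_1,\dots,\widehat{e_i},\widehat{e_{i+1}},\dots,e_n,e)\cdot\langle e_i,e_{i+1}\rangle$. A $0$-ary pre-Courant structure is simply an element of $\Gamma(E)$ (with vanishing symbol). $\mathcal{C}^{n+1}(E)$ denotes the space of all $n$-ary pre-Courant structures, so $\mathcal{C}^1(E)=\Gamma(E)$ and an element of $\mathcal{C}^n(E)$ takes $n-1$ arguments; also $\mathcal{C}^0(E)=C^\infty(M)$. Definition of the interior product. Given $C_1\in\mathcal{C}^n(E)$ and $C_2\in\mathcal{C}^m(E)$, $n,m\ge1$, the interior product $\imath_{C_2}C_1\in\mathcal{C}^{n+m-2}(E)$ is defined, for all $e_1,\dots,e_{n+m-3}\in\Gamma(E)$, by $$\imath_{C_2}C_1(e_1,\dots,e_{n+m-3})=\sum\mathrm{sgn}(J,I)\,(-1)^t\,C_1\big(e_{i_1},\dots,e_{i_t},C_2(e_{j_1},\dots,e_{j_{m-1}}),e_{i_{t+1}},\dots,e_{i_{n-2}}\big),$$ where the sum is over all shuffles $I=\{i_1<\dots<i_{n-2}\}\subset N=\{1,\dots,n+m-3\}$; the $j$'s and $t$ are defined by $\{j_1<\dots<j_{m-1}\}=N\setminus I$ and $i_{t+1}=j_{m-1}+1$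 or, in case $j_{m-1}=n+m-3$, $t:=n-2$; and $(J,I)$ denotes the permutation $(j_1,\dots,j_{m-1},i_1,\dots,i_{n-2})$ of $N$. When $C_2=e\in\mathcal{C}^1(E)=\Gamma(E)$, $\imath_eC_1$ is given by $\imath_eC_1(e_1,\dots,e_{n-2})=C_1(e,e_1,\dots,e_{n-2})$, and $\imath_e e_1=\langle e,e_1\rangle$ if $C_1=e_1\in\Gamma(E)$. *)

theory Defs
  imports "HOL-Analysis.Analysis" "HOL-Combinatorics.Permutations"
begin

section \<open>Smooth manifolds\<close>

text \<open>Only meaningful for open \<open>S\<close>. In finite dimension this is the usual class \<open>C^k\<close>, expressed
  through iterated directional derivatives.\<close>

primrec Ck_on :: "nat \<Rightarrow> ('a::real_normed_vector \<Rightarrow> 'b::real_normed_vector) \<Rightarrow> 'a set \<Rightarrow> bool" where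
  "Ck_on 0 f S \<longleftrightarrow> continuous_on S f"
| "Ck_on (Suc k) f S \<longleftrightarrow>
     (\<forall>x\<in>S. f differentiable (at x)) \<and> (\<forall>v. Ck_on k (\<lambda>x. frechet_derivative f (at x) v) S)"

definition smooth_on :: "'a::real_normed_vector set \<Rightarrow> ('a \<Rightarrow> 'b::real_normed_vector) \<Rightarrow> bool" where
  "smooth_on S f \<longleftrightarrow> (\<forall>k. Ck_on k f S)"

text \<open>Local models are types of class \<^class>\<open>real_normed_vector\<close> that are finite-dimensional, rather
  than of class \<^class>\<open>euclidean_space\<close>, because the latter excludes dimension (or rank) \<open>0\<close>.\<close>

definition finite_dimensional_type :: "'a::real_normed_vector itself \<Rightarrow> bool" where
  "finite_dimensional_type _ \<longleftrightarrow> (\<exists>B::'a set. finite B \<and> span B = UNIV)"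

type_synonym ('m, 'd) atlas = "('m set \<times> ('m \<Rightarrow> 'd)) set"

definition smooth_atlas ::
  "('m::{t2_space,second_countable_topology}, 'd::real_normed_vector) atlas \<Rightarrow> bool" where
  "smooth_atlas A \<longleftrightarrow>
     finite_dimensional_type TYPE('d) \<and>
     (\<Union>(U, \<phi>)\<in>A. U) = UNIV \<and>
     (\<forall>(U, \<phi>)\<in>A. open U \<and> open (\<phi> ` U) \<and> (\<exists>\<phi>'. homeomorphism U (\<phi> ` U) \<phi> \<phi>')) \<and>
     (\<forall>(U, \<phi>)\<in>A. \<forall>(V, \<eta>)\<in>A. smooth_on (\<phi> ` (U \<inter> V)) (\<eta> \<circ> inv_into U \<phi>))"

text \<open>Smoothness of a vector-valued map on an open subset \<open>W\<close> of the manifold.\<close>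

definition smooth_map_on ::
  "('m, 'd::real_normed_vector) atlas \<Rightarrow> 'm set \<Rightarrow> ('m \<Rightarrow> 'b::real_normed_vector) \<Rightarrow> bool" where
  "smooth_map_on A W f \<longleftrightarrow> (\<forall>(U, \<phi>)\<in>A. smooth_on (\<phi> ` (U \<inter> W)) (f \<circ> inv_into U \<phi>))"

definition smooth_functions :: "('m, 'd::real_normed_vector) atlas \<Rightarrow> ('m \<Rightarrow> real) set" where
  "smooth_functions A = {f. smooth_map_on A UNIV f}"

text \<open>Vector fields are the derivations of the algebra of smooth functions.\<close>

definition vector_fields ::
  "('m, 'd::real_normed_vector) atlas \<Rightarrow> (('m \<Rightarrow> real) \<Rightarrow> ('m \<Rightarrow> real)) set" where
  "vector_fields A = {X \<in> smooth_functions A \<rightarrow>\<^sub>E smooth_functions A.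
     (\<forall>f\<in>smooth_functions A. \<forall>h\<in>smooth_functions A. \<forall>a.
        X (\<lambda>x. a * f x + h x) = (\<lambda>x. a * X f x + X h x) \<and>
        X (\<lambda>x. f x * h x) = (\<lambda>x. f x * X h x + h x * X f x))}"

section \<open>Vector bundles with a fibre metric\<close>

text \<open>The fibre over \<open>x\<close> is a linear subspace \<open>E x\<close> of a real vector space \<open>'v\<close> that carries no further
  structure. This is no restriction: \<open>'v\<close> may be the direct sum of all the fibres. The set \<open>T\<close> consists
  of local trivialisations \<open>(U, \<psi>)\<close>, where \<open>\<psi> x\<close> identifies \<open>E x\<close> with the model fibre \<open>'f\<close> for
  \<open>x \<in> U\<close>; it determines the topology and the smooth structure of the total space.\<close>

type_synonym ('m, 'v, 'f) trivialisations = "('m set \<times> ('m \<Rightarrow> 'v \<Rightarrow> 'f)) set"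

definition smooth_vector_bundle ::
  "('m::{t2_space,second_countable_topology}, 'd::real_normed_vector) atlas \<Rightarrow>
   ('m \<Rightarrow> 'v::real_vector set) \<Rightarrow> ('m, 'v, 'f::real_normed_vector) trivialisations \<Rightarrow> bool" where
  "smooth_vector_bundle A E T \<longleftrightarrow>
     smooth_atlas A \<and> finite_dimensional_type TYPE('f) \<and>
     (\<forall>x. subspace (E x)) \<and>
     (\<Union>(U, \<psi>)\<in>T. U) = UNIV \<and>
     (\<forall>(U, \<psi>)\<in>T. open U \<and>
        (\<forall>x\<in>U. bij_betw (\<psi> x) (E x) UNIV \<and>
           (\<forall>u\<in>E x. \<forall>v\<in>E x. \<forall>a. \<psi> x (a *\<^sub>R u + v) = a *\<^sub>R \<psi> x u + \<psi> x v))) \<and>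
     (\<forall>(U, \<psi>)\<in>T. \<forall>(V, \<eta>)\<in>T. \<forall>a.
        smooth_map_on A (U \<inter> V) (\<lambda>x. \<eta> x (inv_into (E x) (\<psi> x) a)))"

text \<open>The space \<open>\<Gamma>(E)\<close>.\<close>

definition sections ::
  "('m, 'd::real_normed_vector) atlas \<Rightarrow> ('m \<Rightarrow> 'v::real_vector set) \<Rightarrow>
   ('m, 'v, 'f::real_normed_vector) trivialisations \<Rightarrow> ('m \<Rightarrow> 'v) set" where
  "sections A E T =
     {s. (\<forall>x. s x \<in> E x) \<and> (\<forall>(U, \<psi>)\<in>T. smooth_map_on A U (\<lambda>x. \<psi> x (s x)))}"

text \<open>A smooth fibrewise non-degenerate symmetric bilinear form. Linearity in the second argument
  follows by symmetry.\<close>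

definition fibre_metric ::
  "('m, 'd::real_normed_vector) atlas \<Rightarrow> ('m \<Rightarrow> 'v::real_vector set) \<Rightarrow>
   ('m, 'v, 'f::real_normed_vector) trivialisations \<Rightarrow> ('m \<Rightarrow> 'v \<Rightarrow> 'v \<Rightarrow> real) \<Rightarrow> bool" where
  "fibre_metric A E T g \<longleftrightarrow>
     (\<forall>x. \<forall>u\<in>E x. \<forall>v\<in>E x. g x u v = g x v u) \<and>
     (\<forall>x. \<forall>u\<in>E x. \<forall>v\<in>E x. \<forall>w\<in>E x. \<forall>a. g x (a *\<^sub>R u + v) w = a * g x u w + g x v w) \<and>
     (\<forall>x. \<forall>u\<in>E x. (\<forall>v\<in>E x. g x u v = 0) \<longrightarrow> u = 0) \<and>
     (\<forall>(U, \<psi>)\<in>T. \<forall>a b.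
        smooth_map_on A U (\<lambda>x. g x (inv_into (E x) (\<psi> x) a) (inv_into (E x) (\<psi> x) b)))"

definition pairing :: "('m \<Rightarrow> 'v \<Rightarrow> 'v \<Rightarrow> real) \<Rightarrow> ('m \<Rightarrow> 'v) \<Rightarrow> ('m \<Rightarrow> 'v) \<Rightarrow> ('m \<Rightarrow> real)" where
  "pairing g s t = (\<lambda>x. g x (s x) (t x))"

section \<open>Pre-Courant structures\<close>

text \<open>A \<open>k\<close>-ary operation takes a list of \<open>k\<close> arguments; a nullary operation \<open>C\<close> is identified with its
  value \<open>C []\<close>. The argument written \<open>e\<^sub>i\<close> in the usual \<open>1\<close>-based indexing is \<open>es ! (i - 1)\<close>.\<close>

definition tuples :: "nat \<Rightarrow> 'a set \<Rightarrow> 'a list set" where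
  "tuples k S = {es. length es = k \<and> set es \<subseteq> S}"

type_synonym ('m, 'v) bracket = "('m \<Rightarrow> 'v) list \<Rightarrow> ('m \<Rightarrow> 'v)"

definition multilinear_bracket ::
  "('m \<Rightarrow> 'v::real_vector) set \<Rightarrow> nat \<Rightarrow> ('m, 'v) bracket \<Rightarrow> bool" where
  "multilinear_bracket \<Gamma> k C \<longleftrightarrow>
     (\<forall>es\<in>tuples k \<Gamma>. \<forall>i<k. \<forall>s\<in>\<Gamma>. \<forall>t\<in>\<Gamma>. \<forall>a.
        C (es[i := (\<lambda>x. a *\<^sub>R s x + t x)]) = (\<lambda>x. a *\<^sub>R C (es[i := s]) x + C (es[i := t]) x))"

definition is_symbol ::
  "('m, 'd::real_normed_vector) atlas \<Rightarrow> ('m \<Rightarrow> 'v::real_vector) set \<Rightarrow>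
   ('m \<Rightarrow> 'v \<Rightarrow> 'v \<Rightarrow> real) \<Rightarrow> nat \<Rightarrow> ('m, 'v) bracket \<Rightarrow>
   (('m \<Rightarrow> 'v) list \<Rightarrow> ('m \<Rightarrow> real) \<Rightarrow> ('m \<Rightarrow> real)) \<Rightarrow> bool" where
  "is_symbol A \<Gamma> g k C \<sigma> \<longleftrightarrow>
     \<sigma> \<in> tuples (k - 1) \<Gamma> \<rightarrow> vector_fields A \<and>
     (\<forall>es\<in>tuples (k - 1) \<Gamma>. \<forall>e\<in>\<Gamma>. \<forall>e'\<in>\<Gamma>.
        \<sigma> es (pairing g e e') =
          (\<lambda>x. pairing g (C (es @ [e])) e' x + pairing g e (C (es @ [e'])) x)) \<and>
     (\<forall>es\<in>tuples k \<Gamma>. \<forall>e\<in>\<Gamma>. \<forall>i. Suc i < k \<longrightarrow>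
        pairing g (\<lambda>x. C es x + C (es[i := es ! Suc i, Suc i := es ! i]) x) e =
          \<sigma> (take i es @ drop (i + 2) es @ [e]) (pairing g (es ! i) (es ! Suc i)))"

definition pre_courant_structures ::
  "('m, 'd::real_normed_vector) atlas \<Rightarrow> ('m \<Rightarrow> 'v::real_vector set) \<Rightarrow>
   ('m, 'v, 'f::real_normed_vector) trivialisations \<Rightarrow> ('m \<Rightarrow> 'v \<Rightarrow> 'v \<Rightarrow> real) \<Rightarrow> nat \<Rightarrow>
   ('m, 'v) bracket set" where
  "pre_courant_structures A E T g k =
     {C \<in> tuples k (sections A E T) \<rightarrow>\<^sub>E sections A E T.
        multilinear_bracket (sections A E T) k C \<and>
        (k \<ge> 1 \<longrightarrow> (\<exists>\<sigma>. is_symbol A (sections A E T) g k C \<sigma>))}"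

text \<open>\<open>\<C>\<^sup>n(E)\<close> for \<open>n \<ge> 1\<close>: its elements take \<open>n - 1\<close> arguments. (The space \<open>\<C>\<^sup>0(E)\<close> of smooth functions
  is not needed.)\<close>

definition courant_space ::
  "('m, 'd::real_normed_vector) atlas \<Rightarrow> ('m \<Rightarrow> 'v::real_vector set) \<Rightarrow>
   ('m, 'v, 'f::real_normed_vector) trivialisations \<Rightarrow> ('m \<Rightarrow> 'v \<Rightarrow> 'v \<Rightarrow> real) \<Rightarrow> nat \<Rightarrow>
   ('m, 'v) bracket set" where
  "courant_space A E T g n = pre_courant_structures A E T g (n - 1)"

section \<open>Interior product\<close>

definition list_sign :: "nat list \<Rightarrow> int" where
  "list_sign xs = sign (permutation_of_list (zip [1..<Suc (length xs)] xs))"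

text \<open>The interior product of \<open>C\<^sub>2 \<in> \<C>\<^sup>m(E)\<close> with \<open>C\<^sub>1 \<in> \<C>\<^sup>n(E)\<close>, where \<open>n, m \<ge> 1\<close> and \<open>n + m \<ge> 3\<close>,
  evaluated on \<open>n + m - 3\<close> sections. For \<open>n = m = 1\<close>, the interior product is the function
  \<open>\<langle>C\<^sub>2, C\<^sub>1\<rangle> \<in> \<C>\<^sup>0(E)\<close>, which is not a bracket and is not covered. For \<open>n = 1 < m\<close> there is no index
  set \<open>I\<close> with \<open>n - 2\<close> elements, and the sum is empty.\<close>

definition interior_product ::
  "nat \<Rightarrow> nat \<Rightarrow> ('m, 'v::real_vector) bracket \<Rightarrow> ('m, 'v) bracket \<Rightarrow> ('m, 'v) bracket" where
  "interior_product n m C\<^sub>2 C\<^sub>1 es =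
     (if m = 1 then C\<^sub>1 (C\<^sub>2 [] # es)
      else (\<lambda>x. \<Sum>I\<in>{I. I \<subseteq> {1..n + m - 3} \<and> card I + 2 = n}.
        let is = sorted_list_of_set I;
            js = sorted_list_of_set ({1..n + m - 3} - I);
            t = (if last js = n + m - 3 then n - 2
                 else (THE t. t < n - 2 \<and> is ! t = last js + 1));
            args = (\<lambda>ls. map (\<lambda>l. es ! (l - 1)) ls)
        in (of_int (list_sign (js @ is)) * (-1) ^ t) *\<^sub>R
           C\<^sub>1 (args (take t is) @ [C\<^sub>2 (args js)] @ args (drop t is)) x))"

section \<open>Unshuffles\<close>

text \<open>The arguments are integers because \<open>Sh(k, -1)\<close> occurs for \<open>m = 1\<close>. The inclusion is automatic for
  \<open>j \<ge> 0\<close>; it says that \<open>\<tau>(1), \<dots>, \<tau>(i)\<close> are values of a permutation of \<open>i + j\<close> elements. Hence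
  \<open>Sh(0, -1)\<close> consists of the empty permutation only, and \<open>Sh(i, -1)\<close> is empty for \<open>i \<ge> 1\<close>.\<close>

definition unshuffles :: "int \<Rightarrow> int \<Rightarrow> (nat \<Rightarrow> nat) set" where
  "unshuffles i j = {\<tau>. \<tau> permutes {1..nat (i + j)} \<and> {1..nat i} \<subseteq> {1..nat (i + j)} \<and>
     strict_mono_on {1..nat i} \<tau> \<and> strict_mono_on {nat i + 1..nat (i + j)} \<tau>}"

text \<open>The list \<open>e\<^bsub>\<tau>(k-(m-2))\<^esub>, \<dots>, e\<^bsub>\<tau>(k-1)\<^esub>, e\<^sub>k\<close> of \<open>m - 1\<close> arguments. It is empty if \<open>m = 1\<close>.\<close>

definition inner_args :: "nat \<Rightarrow> nat \<Rightarrow> (nat \<Rightarrow> nat) \<Rightarrow> 'a list \<Rightarrow> 'a list" where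
  "inner_args m k \<tau> es =
     (if m = 1 then [] else map (\<lambda>r. es ! (\<tau> r - 1)) [k + 2 - m..<k] @ [es ! (k - 1)])"

end

theory Submission
  imports Defs
begin

text \<open>For \<open>m \<ge> 2\<close>, sort the index sets \<open>I\<close> by the largest element \<open>k\<close> of the complement \<open>J\<close>: all indices
  above \<open>k\<close> lie in \<open>I\<close>, so \<open>I\<close> amounts to a splitting of \<open>{1..k - 1}\<close> into the \<open>t = k - (m - 1)\<close>
  elements of \<open>I\<close> below \<open>k\<close> and the other \<open>m - 2\<close> elements of \<open>J\<close>, that is, to an unshuffle \<open>\<tau>\<close>.
  The word \<open>(J, I)\<close> is \<open>\<tau>\<close> composed with the exchange of adjacent blocks of lengths \<open>m - 1\<close> and \<open>t\<close>, so its
  sign is \<open>sgn(\<tau>) (-1)^(t (m - 1))\<close>. Together with \<open>(-1)^t\<close> this gives \<open>(-1)^(t m) = (-1)^(m k)\<close>, as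
  \<open>m (m - 1)\<close> is even.\<close>

section \<open>Words as permutations, cyclic shifts and their signs\<close>

definition word_perm :: "nat list \<Rightarrow> nat \<Rightarrow> nat" where
  "word_perm xs = permutation_of_list (zip [1..<Suc (length xs)] xs)"

lemma list_sign_word_perm: "list_sign xs = sign (word_perm xs)"
  by (simp add: list_sign_def word_perm_def)

lemma word_perm_apply:
  "word_perm xs r = (if r \<in> {1..length xs} then xs ! (r - 1) else r)"
proof (cases "r \<in> {1..length xs}")
  case True
  then have "map_of (zip [1..<Suc (length xs)] xs) ([1..<Suc (length xs)] ! (r - 1)) = Some (xs ! (r - 1))"
    by (intro map_of_zip_nth) auto
  with True show ?thesis
    by (simp add: word_perm_def permutation_of_list_def del: upt_Suc)
next
  case False
  then have "map_of (zip [1..<Suc (length xs)] xs) r = None"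
    by (auto simp del: upt_Suc)
  then show ?thesis
    unfolding word_perm_def permutation_of_list_def using False by (simp only: option.case if_False)
qed

lemma word_perm_permutes:
  assumes "distinct xs" and "set xs = {1..length xs}"
  shows "word_perm xs permutes {1..length xs}"
proof -
  have "map fst (zip [1..<Suc (length xs)] xs) = [1..<Suc (length xs)]"
    "map snd (zip [1..<Suc (length xs)] xs) = xs"
    by (simp_all del: upt_Suc)
  then have "list_permutes (zip [1..<Suc (length xs)] xs) {1..length xs}"
    unfolding list_permutes_def using assms
    by (simp only: set_upt atLeastLessThanSuc_atLeastAtMost distinct_upt) simp
  then show ?thesis
    unfolding word_perm_def by (rule permutation_of_list_permutes)
qed

text \<open>For \<open>t \<le> k\<close> this is the permutation with word
  \<open>t + 1, ..., k, 1, ..., t\<close>, the exchange of two adjacent blocks of lengths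
  \<open>k - t\<close> and \<open>t\<close>.\<close>

definition cyclic_shift :: "nat \<Rightarrow> nat \<Rightarrow> nat \<Rightarrow> nat" where
  "cyclic_shift k t i =
     (if i \<in> {1..k} then if i + t \<le> k then i + t else i + t - k else i)"

text \<open>Induction on the cycle length: composing with the transposition of 1 and the new point
  lengthens the cycle by one and flips the sign.\<close>

lemma permutation_and_sign_cyclic_shift_1:
  "permutation (cyclic_shift (Suc k) 1) \<and> sign (cyclic_shift (Suc k) 1) = (-1) ^ k"
proof (induction k)
  case 0
  have "cyclic_shift (Suc 0) 1 = id"
    by (auto simp: cyclic_shift_def)
  then show ?case by simp
next
  case (Suc k)
  have "cyclic_shift (Suc (Suc k)) 1 = Transposition.transpose 1 (Suc (Suc k)) \<circ> cyclic_shift (Suc k) 1"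
    by (rule ext) (auto simp: cyclic_shift_def Transposition.transpose_def)
  note * = this
  show ?case
    unfolding * using Suc
    by (simp add: permutation_compose permutation_swap_id sign_compose sign_swap_id del: comp_apply)
qed

text \<open>The shift by \<open>t\<close> is the \<open>t\<close>-fold iterate of the shift by 1,
  and each iteration contributes \<open>(-1) ^ k\<close>. The bound on \<open>t\<close> ensures that
  the explicit formula wraps around at most once. Being a permutation is part of the induction
  because \<open>sign_compose\<close> asks for it.\<close>

lemma permutation_and_sign_cyclic_shift:
  assumes "t \<le> Suc k"
  shows "permutation (cyclic_shift (Suc k) t) \<and> sign (cyclic_shift (Suc k) t) = (-1) ^ (k * t)"
  using assms
proof (induction t)
  case 0
  have "cyclic_shift (Suc k) 0 = id"
    by (auto simp: cyclic_shift_def)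
  then show ?case by simp
next
  case (Suc t)
  have "cyclic_shift (Suc k) (Suc t) = cyclic_shift (Suc k) 1 \<circ> cyclic_shift (Suc k) t"
    using Suc.prems by (intro ext) (auto simp: cyclic_shift_def)
  note * = this
  show ?case
    unfolding * using Suc permutation_and_sign_cyclic_shift_1[of k]
    by (simp add: permutation_compose sign_compose power_add del: comp_apply)
qed

section \<open>Increasing maps and unshuffles\<close>

lemma sorted_map_upt:
  fixes f :: "nat \<Rightarrow> nat"
  assumes "strict_mono_on {a..<b} f"
  shows "sorted_wrt (<) (map f [a..<b])"
  by (auto simp: sorted_wrt_iff_nth_less intro!: strict_mono_onD[OF assms])

lemma strict_mono_on_if_sorted_nth:
  fixes xs :: "nat list"
  assumes "sorted_wrt (<) xs" and "\<And>i. i < length xs \<Longrightarrow> f (a + i) = xs ! i"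
  shows "strict_mono_on {a..<a + length xs} f"
proof (rule strict_mono_onI)
  fix r s assume "r \<in> {a..<a + length xs}" "s \<in> {a..<a + length xs}" "r < s"
  then have "xs ! (r - a) < xs ! (s - a)"
    by (intro sorted_wrt_nth_less[OF assms(1)]) auto
  moreover have "f r = xs ! (r - a)" "f s = xs ! (s - a)"
    using assms(2)[of "r - a"] assms(2)[of "s - a"]
      \<open>r \<in> _\<close> \<open>s \<in> _\<close> by auto
  ultimately show "f r < f s" by simp
qed

text \<open>The half-open intervals match the list ranges \<open>[a..<b]\<close> over which \<tau>
  is mapped later.\<close>

lemma unshuffles_nat:
  "\<tau> \<in> unshuffles (int t) (int p) \<longleftrightarrow>
     \<tau> permutes {1..t + p} \<and> strict_mono_on {1..<Suc t} \<tau> \<and> strict_mono_on {Suc t..<Suc (t + p)} \<tau>"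
proof -
  have "nat (int t + int p) = t + p" by simp
  then show ?thesis
    by (auto simp: unshuffles_def atLeastLessThanSuc_atLeastAtMost)
qed

text \<open>This serves the case \<open>m = 1\<close>, where it leaves only one term of the double
  sum. For positive \<open>t\<close> the required inclusion of \<open>{1..t}\<close> in
  \<open>{1..t - 1}\<close> fails.\<close>

lemma unshuffles_neg1: "unshuffles (int t) (-1) = (if t = 0 then {id} else {})"
proof (cases t)
  case (Suc s)
  then have "nat (int t + -1) = s" by simp
  moreover have "\<not> {1..t} \<subseteq> {1..s}" using Suc by auto
  ultimately show ?thesis using Suc by (auto simp: unshuffles_def)
qed (auto simp: unshuffles_def strict_mono_on_def)

lemma finite_unshuffles: "finite (unshuffles i j)"
proof (rule finite_subset)
  show "unshuffles i j \<subseteq> {\<tau>. \<tau> permutes {1..nat (i + j)}}"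
    by (auto simp: unshuffles_def)
qed (simp add: finite_permutations)

text \<open>The index set I coded by the pair \<open>(k, \<tau>)\<close>, where \<open>k\<close> is
  to be the largest index outside I. The block length \<open>t\<close> is a separate argument, so
  that \<open>k = Suc (t + p)\<close> replaces truncated subtraction.\<close>

definition shuffle_set :: "nat \<Rightarrow> nat \<Rightarrow> nat \<Rightarrow> (nat \<Rightarrow> nat) \<Rightarrow> nat set" where
  "shuffle_set N k t \<tau> = \<tau> ` {1..t} \<union> {Suc k..N}"

text \<open>An unshuffle of \<open>t + p\<close> elements takes values below \<open>k\<close> on
  both blocks. So the two lists on the right are strictly increasing, and such a list is determined
  by its set of entries.\<close>

lemma
  assumes \<tau>: "\<tau> \<in> unshuffles (int t) (int p)" and k: "k = Suc (t + p)" and N: "k \<le> N"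
  shows shuffle_set_subset: "shuffle_set N k t \<tau> \<subseteq> {1..N}"
    and card_shuffle_set: "card (shuffle_set N k t \<tau>) = t + (N - k)"
    and sorted_shuffle_set:
      "sorted_list_of_set (shuffle_set N k t \<tau>) = map \<tau> [1..<Suc t] @ [Suc k..<Suc N]"
    and sorted_compl_shuffle_set:
      "sorted_list_of_set ({1..N} - shuffle_set N k t \<tau>) = map \<tau> [Suc t..<k] @ [k]"
proof -
  have perm: "\<tau> permutes {1..t + p}"
    and mono: "strict_mono_on {1..<Suc t} \<tau>" "strict_mono_on {Suc t..<k} \<tau>"
    using \<tau> by (auto simp: unshuffles_nat k)
  have inj: "inj \<tau>" using perm by (rule permutes_inj)
  have img: "\<tau> ` {1..t + p} = {1..t + p}" using perm by (rule permutes_image)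
  have le: "\<tau> r \<in> {1..t + p}" if "r \<in> {1..t + p}" for r
    using img that by blast
  show sub: "shuffle_set N k t \<tau> \<subseteq> {1..N}"
    using le N by (fastforce simp: shuffle_set_def k)
  have fin: "finite (shuffle_set N k t \<tau>)" by (simp add: shuffle_set_def)
  let ?is = "map \<tau> [1..<Suc t] @ [Suc k..<Suc N]" and ?js = "map \<tau> [Suc t..<k] @ [k]"
  have is_sorted: "sorted_wrt (<) ?is"
  proof -
    have "\<tau> r < k" if "r \<in> {1..<Suc t}" for r
      using le[of r] that by (auto simp: k)
    then show ?thesis
      using sorted_map_upt[OF mono(1)]
      by (fastforce simp: sorted_wrt_append simp del: upt_Suc)
  qed
  have js_sorted: "sorted_wrt (<) ?js"
  proof -
    have "\<tau> r < k" if "r \<in> {Suc t..<k}" for r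
      using le[of r] that by (auto simp: k)
    then show ?thesis
      using sorted_map_upt[OF mono(2)]
      by (auto simp: sorted_wrt_append)
  qed
  have is_set: "set ?is = shuffle_set N k t \<tau>"
    by (auto simp: shuffle_set_def atLeastLessThanSuc_atLeastAtMost simp del: upt_Suc)
  \<comment> \<open>The complement comes from cutting \<open>{1..N}\<close> into the images of the
    two blocks under \<tau>, the point \<open>k\<close>, and the indices above \<open>k\<close>, all
    pairwise disjoint.\<close>
  have "{1..t + p} = {1..t} \<union> {Suc t..t + p}" by auto
  then have split: "{1..t + p} = \<tau> ` {1..t} \<union> \<tau> ` {Suc t..t + p}"
    using img by (simp add: image_Un[symmetric])
  have disj: "\<tau> ` {1..t} \<inter> \<tau> ` {Suc t..t + p} = {}"
    by (simp flip: image_Int[OF inj])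
  have "{1..N} = {1..t + p} \<union> {k} \<union> {Suc k..N}"
    using N k by (intro set_eqI, simp only: Un_iff atLeastAtMost_iff singleton_iff) arith
  moreover have "k \<notin> \<tau> ` {1..t}" "\<tau> ` {Suc t..t + p} \<inter> {Suc k..N} = {}"
  proof -
    have "x < k" if "x \<in> \<tau> ` {1..t + p}" for x
      using that unfolding img k by simp
    moreover have "{1..t} \<subseteq> {1..t + p}" "{Suc t..t + p} \<subseteq> {1..t + p}" by auto
    ultimately show "k \<notin> \<tau> ` {1..t}" "\<tau> ` {Suc t..t + p} \<inter> {Suc k..N} = {}"
      by fastforce+
  qed
  moreover have "k \<notin> {Suc k..N}" by simp
  ultimately have "{1..N} - shuffle_set N k t \<tau> = insert k (\<tau> ` {Suc t..t + p})"
    unfolding shuffle_set_def split using disj by blast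
  then have js_set: "set ?js = {1..N} - shuffle_set N k t \<tau>"
    by (simp add: k atLeastLessThanSuc_atLeastAtMost del: upt_Suc)
  show *: "sorted_list_of_set (shuffle_set N k t \<tau>) = ?is"
    by (metis is_set is_sorted sorted_list_of_set.idem_if_sorted_distinct strict_sorted_iff)
  show "sorted_list_of_set ({1..N} - shuffle_set N k t \<tau>) = ?js"
    by (metis js_set js_sorted sorted_list_of_set.idem_if_sorted_distinct strict_sorted_iff)
  show "card (shuffle_set N k t \<tau>) = t + (N - k)"
    using arg_cong[OF *, of length] by (simp del: upt_Suc)
qed

lemma list_sign_shuffle:
  assumes \<tau>: "\<tau> \<in> unshuffles (int t) (int p)" and k: "k = Suc (t + p)" and N: "k \<le> N"
  shows "list_sign ((map \<tau> [Suc t..<k] @ [k]) @ map \<tau> [1..<Suc t] @ [Suc k..<Suc N]) =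
    sign \<tau> * (-1) ^ (t * Suc p)"
proof -
  have perm: "\<tau> permutes {1..t + p}" using \<tau> by (simp add: unshuffles_nat)
  \<comment> \<open>Since \<tau> fixes \<open>k\<close> and everything above, the entries
    \<open>k, ..., N\<close> of the word are values of \<tau> too, and the whole word factors
    through \<tau>.\<close>
  then have fixed: "\<tau> r = r" if "r > t + p" for r
    using that by (auto simp: permutes_def)
  have fixed0: "\<tau> 0 = 0" using perm by (auto simp: permutes_def)
  let ?xs = "(map \<tau> [Suc t..<k] @ [k]) @ map \<tau> [1..<Suc t] @ [Suc k..<Suc N]"
  \<comment> \<open>The shift by \<open>t\<close> exchanges the block of the \<open>p + 1\<close> indices in \<open>J\<close> with the block of the \<open>t\<close>
    indices of \<open>I\<close> below \<open>k\<close>.\<close>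
  have "word_perm ?xs = \<tau> \<circ> cyclic_shift k t"
  proof
    fix i
    show "word_perm ?xs i = (\<tau> \<circ> cyclic_shift k t) i"
    proof (cases i)
      case 0
      then show ?thesis by (simp add: word_perm_apply cyclic_shift_def fixed0 del: upt_Suc)
    next
      case (Suc j)
      then show ?thesis
        using N by (auto simp: word_perm_apply cyclic_shift_def nth_append k fixed
            simp del: upt_Suc intro!: arg_cong[where f = \<tau>])
    qed
  qed
  moreover have "permutation \<tau>" using perm permutation_permutes by blast
  moreover have "permutation (cyclic_shift k t)" "sign (cyclic_shift k t) = (-1) ^ ((t + p) * t)"
    using permutation_and_sign_cyclic_shift[of t "t + p"] by (simp_all add: k)
  \<comment> \<open>The two exponents differ by \<open>t * (t - 1)\<close>, which is even.\<close>
  moreover have "(-1 :: int) ^ ((t + p) * t) = (-1) ^ (t * Suc p)"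
    by (auto simp: minus_one_power_iff)
  ultimately show ?thesis
    by (simp add: list_sign_word_perm sign_compose del: upt_Suc)
qed

section \<open>The bijection between pairs (k, \<tau>) and index sets\<close>

lemma inj_on_shuffle_set:
  "inj_on (\<lambda>(k, \<tau>). shuffle_set N k (k - Suc p) \<tau>)
     (SIGMA k:{Suc p..N}. unshuffles (int (k - Suc p)) (int p))"
  (is "inj_on ?h ?S")
proof (rule inj_onI)
  fix x y assume xy: "x \<in> ?S" "y \<in> ?S" "?h x = ?h y"
  obtain k \<tau> k' \<tau>' where x: "x = (k, \<tau>)" and y: "y = (k', \<tau>')"
    by (cases x, cases y)
  have k: "Suc p \<le> k" "k \<le> N" and k': "Suc p \<le> k'" "k' \<le> N"
    and \<tau>: "\<tau> \<in> unshuffles (int (k - Suc p)) (int p)"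
    and \<tau>': "\<tau>' \<in> unshuffles (int (k' - Suc p)) (int p)"
    and eq: "shuffle_set N k (k - Suc p) \<tau> = shuffle_set N k' (k' - Suc p) \<tau>'"
    using xy unfolding x y by (simp_all only: mem_Sigma_iff prod.case atLeastAtMost_iff)
  have ke: "k = Suc (k - Suc p + p)" and ke': "k' = Suc (k' - Suc p + p)"
    using k k' by auto
  define t where "t = k - Suc p"
  note srt = sorted_shuffle_set[OF \<tau> ke k(2)] sorted_shuffle_set[OF \<tau>' ke' k'(2)]
  note cmp = sorted_compl_shuffle_set[OF \<tau> ke k(2)] sorted_compl_shuffle_set[OF \<tau>' ke' k'(2)]
  \<comment> \<open>Equal sets have equal sorted complements. Their last entries give
    \<open>k = k'\<close>, the other entries give agreement on the second block, and the sorted sets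
    themselves give agreement on the first.\<close>
  have "map \<tau> [Suc (k - Suc p)..<k] @ [k] = map \<tau>' [Suc (k' - Suc p)..<k'] @ [k']"
    by (simp only: eq flip: cmp)
  then have "map \<tau> [Suc (k - Suc p)..<k] = map \<tau>' [Suc (k' - Suc p)..<k'] \<and> k = k'"
    by (rule append1_eq_conv[THEN iffD1])
  then have kk: "k = k'"
    and "map \<tau> [Suc (k - Suc p)..<k] = map \<tau>' [Suc (k' - Suc p)..<k']"
    by blast+
  then have js: "map \<tau> [Suc t..<k] = map \<tau>' [Suc t..<k]"
    by (simp only: t_def kk)
  have is': "map \<tau> [1..<Suc t] = map \<tau>' [1..<Suc t]"
    using srt eq kk by (simp add: t_def del: upt_Suc)
  have "\<tau> r = \<tau>' r" for r
  proof (cases "r \<in> {1..k - 1}")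
    case True
    then have "r \<in> set [1..<Suc t] \<or> r \<in> set [Suc t..<k]" by auto
    with js is' show ?thesis by (auto simp del: upt_Suc)
  next
    case False
    moreover have "\<tau> permutes {1..k - 1}" "\<tau>' permutes {1..k - 1}"
    proof -
      have "k - 1 = k - Suc p + p" using k by simp
      then show "\<tau> permutes {1..k - 1}" "\<tau>' permutes {1..k - 1}"
        using \<tau> \<tau>' kk by (simp_all only: unshuffles_nat)
    qed
    ultimately show ?thesis by (simp add: permutes_not_in)
  qed
  with kk show "x = y" unfolding x y by auto
qed

text \<open>Surjectivity, with \<open>k\<close> the maximum of the complement of I and
  \<open>t\<close> the number of elements of I below \<open>k\<close>. The bound on \<open>t\<close>
  yields \<open>Suc (t + p) \<le> N\<close>, so that \<open>k\<close> stays in the range of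
  summation.\<close>

lemma ex_shuffle_set:
  assumes I: "I \<subseteq> {1..N}" and card_I: "card I + Suc p = N"
  shows "\<exists>t \<tau>. t \<le> card I \<and> \<tau> \<in> unshuffles (int t) (int p) \<and> I = shuffle_set N (Suc (t + p)) t \<tau>"
proof -
  define J where "J = {1..N} - I"
  define k where "k = Max J"
  define A where "A = I \<inter> {1..<k}"
  define t where "t = card A"
  have fin: "finite I" "finite J" "finite A"
    using I by (auto simp: J_def A_def intro: finite_subset)
  \<comment> \<open>In particular J is nonempty, so its maximum is attained.\<close>
  have "card J = Suc p"
    using card_I I fin by (simp add: J_def card_Diff_subset)
  then have kJ: "k \<in> J" and card_J: "card (J - {k}) = p"
  proof -
    show "k \<in> J" unfolding k_def
      using fin \<open>card J = Suc p\<close> by (intro Max_in) auto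
    with \<open>card J = Suc p\<close> show "card (J - {k}) = p" by simp
  qed
  have J_le: "j \<le> k" if "j \<in> J" for j using that fin by (simp add: k_def)
  have un: "A \<union> (J - {k}) = {1..<k}" and disj: "A \<inter> (J - {k}) = {}"
  proof -
    have "j \<in> {1..<k}" if "j \<in> J - {k}" for j
      using that J_le[of j] by (auto simp: J_def)
    moreover have "j \<in> A \<union> (J - {k})" if "j \<in> {1..<k}" for j
      using that kJ by (auto simp: A_def J_def)
    moreover have "A \<subseteq> {1..<k}" by (auto simp: A_def)
    ultimately show "A \<union> (J - {k}) = {1..<k}" by blast
  qed (auto simp: A_def J_def)
  have "card {1..<k} = t + p"
    unfolding un[symmetric] t_def card_J[symmetric] using fin disj by (intro card_Un_disjoint) auto
  moreover have "k \<ge> 1" using kJ by (auto simp: J_def)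
  ultimately have k: "k = Suc (t + p)" by auto
  have I_eq: "I = A \<union> {Suc k..N}"
  proof (intro equalityI subsetI)
    fix i assume "i \<in> I"
    moreover from this have "i \<in> {1..N}" "i \<noteq> k" using I kJ by (auto simp: J_def)
    ultimately show "i \<in> A \<union> {Suc k..N}" by (auto simp: A_def)
  next
    fix i assume i: "i \<in> A \<union> {Suc k..N}"
    show "i \<in> I"
    proof (rule ccontr)
      assume "i \<notin> I"
      with i have "i \<in> J" "k < i" by (auto simp: A_def J_def)
      with J_le show False by fastforce
    qed
  qed
  \<comment> \<open>The word of \<tau>: the elements of I below \<open>k\<close> in increasing
    order, then those of J other than \<open>k\<close>.\<close>
  define xs where "xs = sorted_list_of_set A @ sorted_list_of_set (J - {k})"
  define \<tau> where "\<tau> = word_perm xs"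
  have len: "length xs = t + p" using card_J by (simp add: xs_def t_def)
  have "set xs = A \<union> (J - {k})" using fin by (simp add: xs_def)
  then have set: "set xs = {1..t + p}"
    by (simp only: un) (simp add: k atLeastLessThanSuc_atLeastAtMost)
  have "distinct xs" using fin disj by (simp add: xs_def)
  then have perm: "\<tau> permutes {1..t + p}"
    using word_perm_permutes[of xs] by (simp add: \<tau>_def len set)
  have app: "\<tau> (1 + i) = sorted_list_of_set A ! i" if "i < t" for i
    using that len by (auto simp: \<tau>_def word_perm_apply xs_def nth_append t_def)
  have app': "\<tau> (Suc t + i) = sorted_list_of_set (J - {k}) ! i" if "i < p" for i
    using that len by (auto simp: \<tau>_def word_perm_apply xs_def nth_append t_def)
  have "strict_mono_on {1..<1 + length (sorted_list_of_set A)} \<tau>"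
    by (rule strict_mono_on_if_sorted_nth) (use app in \<open>auto simp: t_def\<close>)
  moreover have "strict_mono_on {Suc t..<Suc t + length (sorted_list_of_set (J - {k}))} \<tau>"
    by (rule strict_mono_on_if_sorted_nth) (use app' card_J in auto)
  ultimately have "\<tau> \<in> unshuffles (int t) (int p)"
    using perm card_J by (simp add: unshuffles_nat t_def)
  moreover have "\<tau> ` {1..t} = A"
  proof -
    have "\<tau> ` {1..t} = set (map \<tau> [1..<Suc t])"
      by (simp add: atLeastLessThanSuc_atLeastAtMost del: upt_Suc)
    also have "map \<tau> [1..<Suc t] = sorted_list_of_set A"
      by (rule nth_equalityI) (use app in \<open>auto simp: t_def simp del: upt_Suc\<close>)
    finally show ?thesis using fin by simp
  qed
  moreover have "t \<le> card I" using fin by (auto simp: t_def A_def intro: card_mono)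
  ultimately show ?thesis
    using I_eq k by (auto simp: shuffle_set_def)
qed

lemma bij_betw_shuffle_set:
  assumes N: "N = q + Suc p"
  shows "bij_betw (\<lambda>(k, \<tau>). shuffle_set N k (k - Suc p) \<tau>)
     (SIGMA k:{Suc p..N}. unshuffles (int (k - Suc p)) (int p)) {I. I \<subseteq> {1..N} \<and> card I = q}"
  unfolding bij_betw_def
proof (intro conjI inj_on_shuffle_set equalityI subsetI)
  fix I
  assume "I \<in> (\<lambda>(k, \<tau>). shuffle_set N k (k - Suc p) \<tau>) `
     (SIGMA k:{Suc p..N}. unshuffles (int (k - Suc p)) (int p))"
  then obtain k \<tau> where k: "Suc p \<le> k" "k \<le> N"
    and \<tau>: "\<tau> \<in> unshuffles (int (k - Suc p)) (int p)" and I: "I = shuffle_set N k (k - Suc p) \<tau>"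
    by auto
  have ke: "k = Suc (k - Suc p + p)" using k by auto
  show "I \<in> {I. I \<subseteq> {1..N} \<and> card I = q}"
    using shuffle_set_subset[OF \<tau> ke k(2)] card_shuffle_set[OF \<tau> ke k(2)] k N I by auto
next
  fix I assume "I \<in> {I. I \<subseteq> {1..N} \<and> card I = q}"
  then obtain t \<tau> where "t \<le> q" "\<tau> \<in> unshuffles (int t) (int p)"
    "I = shuffle_set N (Suc (t + p)) t \<tau>"
    using ex_shuffle_set[of I N p] N by auto
  then show "I \<in> (\<lambda>(k, \<tau>). shuffle_set N k (k - Suc p) \<tau>) `
     (SIGMA k:{Suc p..N}. unshuffles (int (k - Suc p)) (int p))"
    using N by (intro image_eqI[of _ _ "(Suc (t + p), \<tau>)"]) auto
qed

section \<open>Comparison of the summands\<close>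

lemma interior_product_summand:
  fixes C\<^sub>1 C\<^sub>2 :: "('m, 'v::real_vector) bracket"
  assumes \<tau>: "\<tau> \<in> unshuffles (int t) (int p)" and k: "k = Suc (t + p)" and N: "N = q + Suc p"
    and t: "t \<le> q" and len: "length es = N"
  shows "(let is = sorted_list_of_set (shuffle_set N k t \<tau>);
              js = sorted_list_of_set ({1..N} - shuffle_set N k t \<tau>);
              t = (if last js = N then q else (THE t. t < q \<and> is ! t = last js + 1));
              args = (\<lambda>ls. map (\<lambda>l. es ! (l - 1)) ls)
          in (of_int (list_sign (js @ is)) * (-1) ^ t) *\<^sub>R
             C\<^sub>1 (args (take t is) @ [C\<^sub>2 (args js)] @ args (drop t is)) x) =
         (of_int (sign \<tau>) * (-1) ^ (Suc (Suc p) * k)) *\<^sub>R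
           C\<^sub>1 (map (\<lambda>r. es ! (\<tau> r - 1)) [1..<Suc t] @
             [C\<^sub>2 (inner_args (Suc (Suc p)) k \<tau> es)] @ drop k es) x"
proof -
  have kN: "k \<le> N" using k N t by simp
  let ?is = "map \<tau> [1..<Suc t] @ [Suc k..<Suc N]" and ?js = "map \<tau> [Suc t..<k] @ [k]"
  note is_eq = sorted_shuffle_set[OF \<tau> k kN] and js_eq = sorted_compl_shuffle_set[OF \<tau> k kN]
  \<comment> \<open>From position \<open>t\<close> on, the list \<open>?is\<close> reads
    \<open>k + 1, ..., N\<close>. If \<open>k = N\<close> this tail is empty and
    \<open>t = q\<close>; otherwise \<open>k + 1\<close> stands at position \<open>t\<close>, and
    nowhere else by distinctness.\<close>
  have t_eq: "(if last ?js = N then q else (THE t. t < q \<and> ?is ! t = last ?js + 1)) = t"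
  proof (cases "k = N")
    case True
    then show ?thesis using k N by simp
  next
    case False
    have "distinct ?is" unfolding is_eq[symmetric] by simp
    moreover have "t < q" using False k N t by simp
    moreover have "length ?is = q" using k N t by (simp del: upt_Suc)
    moreover have "?is ! t = Suc k"
      using False kN by (simp add: nth_append del: upt_Suc)
    ultimately have "(THE t. t < q \<and> ?is ! t = Suc k) = t"
      using nth_eq_iff_index_eq[of ?is] by (intro the_equality) metis+
    then show ?thesis using False by (simp del: upt_Suc)
  qed
  have args_take: "map (\<lambda>l. es ! (l - 1)) (take t ?is) = map (\<lambda>r. es ! (\<tau> r - 1)) [1..<Suc t]"
    by (simp add: comp_def del: upt_Suc)
  \<comment> \<open>Indices are 1-based and list positions 0-based, so the sections with indices
    \<open>k + 1, ..., N\<close> are those left after dropping \<open>k\<close>.\<close>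
  have args_drop: "map (\<lambda>l. es ! (l - 1)) (drop t ?is) = drop k es"
    by (rule nth_equalityI) (use len in \<open>auto simp del: upt_Suc\<close>)
  have args_js: "map (\<lambda>l. es ! (l - 1)) ?js = inner_args (Suc (Suc p)) k \<tau> es"
    using k by (simp add: inner_args_def comp_def del: upt_Suc)
  \<comment> \<open>The exponents \<open>t * (p + 1) + t\<close> and
    \<open>(p + 2) * (t + p + 1)\<close> differ by the even number
    \<open>(p + 1) * (p + 2)\<close>.\<close>
  have sgn: "real_of_int (list_sign (?js @ ?is)) * (-1) ^ t
      = of_int (sign \<tau>) * (-1) ^ (Suc (Suc p) * k)"
    unfolding list_sign_shuffle[OF \<tau> k kN]
    by (auto simp: k minus_one_power_iff)
  show ?thesis
    unfolding is_eq js_eq Let_def t_eq args_take args_drop args_js sgn ..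
qed

section \<open>The interior product as a double sum\<close>

theorem lemma3p7:
  fixes A :: "('m::{t2_space,second_countable_topology}, 'd::real_normed_vector) atlas"
    and E :: "'m \<Rightarrow> 'v::real_vector set"
    and T :: "('m, 'v, 'f::real_normed_vector) trivialisations"
    and g :: "'m \<Rightarrow> 'v \<Rightarrow> 'v \<Rightarrow> real"
    and n m :: nat
    and C\<^sub>1 C\<^sub>2 :: "('m, 'v) bracket"
    and es :: "('m \<Rightarrow> 'v) list"
  assumes "smooth_vector_bundle A E T" and "fibre_metric A E T g"
    and "n \<ge> 1" and "m \<ge> 1" and "n + m \<ge> 3"
    and "C\<^sub>1 \<in> courant_space A E T g n" and "C\<^sub>2 \<in> courant_space A E T g m"
    and "es \<in> tuples (n + m - 3) (sections A E T)"
  shows "interior_product n m C\<^sub>2 C\<^sub>1 es =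
    (\<lambda>x. \<Sum>k\<in>{m - 1..n + m - 3}. \<Sum>\<tau>\<in>unshuffles (int k - (int m - 1)) (int m - 2).
       (of_int (sign \<tau>) * (-1) ^ (m * k)) *\<^sub>R
       C\<^sub>1 (map (\<lambda>r. es ! (\<tau> r - 1)) [1..<k + 2 - m] @
           [C\<^sub>2 (inner_args m k \<tau> es)] @ drop k es) x)"
proof (cases "m = 1")
  case True
  have len: "length es = n - 2" using assms(8) True by (simp add: tuples_def)
  have "(\<Sum>k\<in>{m - 1..n + m - 3}. \<Sum>\<tau>\<in>unshuffles (int k - (int m - 1)) (int m - 2).
       (of_int (sign \<tau>) * (-1) ^ (m * k)) *\<^sub>R
       C\<^sub>1 (map (\<lambda>r. es ! (\<tau> r - 1)) [1..<k + 2 - m] @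
           [C\<^sub>2 (inner_args m k \<tau> es)] @ drop k es) x) = C\<^sub>1 (C\<^sub>2 [] # es) x" for x
  proof -
    \<comment> \<open>For \<open>m = 1\<close> the inner sum runs over
      \<open>unshuffles (int k) (-1)\<close>: it is empty for positive \<open>k\<close>, and only
      the identity remains for \<open>k = 0\<close>.\<close>
    have "(\<Sum>k\<in>{0..n - 2}. \<Sum>\<tau>\<in>unshuffles (int k) (-1).
       (of_int (sign \<tau>) * (-1) ^ k) *\<^sub>R
       C\<^sub>1 (map (\<lambda>r. es ! (\<tau> r - 1)) [1..<k + 1] @ [C\<^sub>2 []] @ drop k es) x)
      = (\<Sum>k\<in>{0..n - 2}. if k = 0 then C\<^sub>1 (C\<^sub>2 [] # es) x else 0)"
      by (rule sum.cong) (auto simp: unshuffles_neg1)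
    then show ?thesis using True by (simp add: inner_args_def)
  qed
  then show ?thesis using True by (simp add: interior_product_def)
next
  case False
  then obtain p where m: "m = Suc (Suc p)"
    using assms(4) by (intro that[of "m - 2"]) auto
  show ?thesis
  \<comment> \<open>For \<open>n = 1\<close> both sides vanish: no I satisfies
    \<open>card I + 2 = 1\<close>, and the range \<open>{m - 1..m - 2}\<close> of \<open>k\<close>
    is empty.\<close>
  proof (cases "n = 1")
    case True
    then show ?thesis using m by (simp add: interior_product_def)
  next
    case False
    then obtain q where n: "n = Suc (Suc q)"
      using assms(3) by (intro that[of "n - 2"]) auto
    define N where "N = q + Suc p"
    have len: "length es = N" and N: "n + m - 3 = N"
      using assms(8) by (auto simp: tuples_def n m N_def)
    show ?thesis
    proof
      fix x
      let ?G = "\<lambda>k \<tau>. (of_int (sign \<tau>) * (-1) ^ (m * k)) *\<^sub>R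
        C\<^sub>1 (map (\<lambda>r. es ! (\<tau> r - 1)) [1..<k + 2 - m] @ [C\<^sub>2 (inner_args m k \<tau> es)] @ drop k es) x"
      let ?F = "\<lambda>I. let is = sorted_list_of_set I;
              js = sorted_list_of_set ({1..N} - I);
              t = (if last js = N then q else (THE t. t < q \<and> is ! t = last js + 1));
              args = (\<lambda>ls. map (\<lambda>l. es ! (l - 1)) ls)
          in (of_int (list_sign (js @ is)) * (-1) ^ t) *\<^sub>R
             C\<^sub>1 (args (take t is) @ [C\<^sub>2 (args js)] @ args (drop t is)) x"
      let ?S = "SIGMA k:{Suc p..N}. unshuffles (int (k - Suc p)) (int p)"
      have "interior_product n m C\<^sub>2 C\<^sub>1 es x = sum ?F {I. I \<subseteq> {1..N} \<and> card I = q}"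
      proof -
        have "m \<noteq> 1" "n - 2 = q" "card I + 2 = n \<longleftrightarrow> card I = q" for I :: "nat set"
          by (auto simp: n m)
        then show ?thesis
          unfolding interior_product_def N by (simp only: if_False)
      qed
      also have "\<dots> = (\<Sum>(k, \<tau>)\<in>?S. ?F (shuffle_set N k (k - Suc p) \<tau>))"
        unfolding sum.reindex_bij_betw[OF bij_betw_shuffle_set[OF N_def], symmetric]
        by (simp only: case_prod_unfold)
      also have "\<dots> = (\<Sum>(k, \<tau>)\<in>?S. ?G k \<tau>)"
      proof (rule sum.cong[OF refl], clarify)
        fix k \<tau> assume k: "k \<in> {Suc p..N}" and \<tau>: "\<tau> \<in> unshuffles (int (k - Suc p)) (int p)"
        from k have "k = Suc (k - Suc p + p)" "k - Suc p \<le> q" and k2: "k + 2 - m = Suc (k - Suc p)"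
          by (auto simp: N_def m)
        from interior_product_summand[OF \<tau> this(1) N_def this(2) len]
        show "?F (shuffle_set N k (k - Suc p) \<tau>) = ?G k \<tau>"
          unfolding k2 unfolding m .
      qed
      also have "\<dots> = (\<Sum>k\<in>{Suc p..N}. \<Sum>\<tau>\<in>unshuffles (int (k - Suc p)) (int p). ?G k \<tau>)"
        by (rule sum.Sigma[symmetric]) (auto simp: finite_unshuffles)
      also have "\<dots> = (\<Sum>k\<in>{m - 1..n + m - 3}.
          \<Sum>\<tau>\<in>unshuffles (int k - (int m - 1)) (int m - 2). ?G k \<tau>)"
      \<comment> \<open>In this range \<open>k\<close> is at least \<open>m - 1\<close>, so the
        truncated difference agrees with the integer one.\<close>
      proof (rule sum.cong)
        fix k assume "k \<in> {m - 1..n + m - 3}"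
        then have "int (k - Suc p) = int k - (int m - 1)" "int p = int m - 2"
          by (auto simp: m)
        then show "(\<Sum>\<tau>\<in>unshuffles (int (k - Suc p)) (int p). ?G k \<tau>) =
            (\<Sum>\<tau>\<in>unshuffles (int k - (int m - 1)) (int m - 2). ?G k \<tau>)"
          by (simp only:)
      qed (use N in \<open>simp add: m\<close>)
      finally show "interior_product n m C\<^sub>2 C\<^sub>1 es x =
        (\<Sum>k\<in>{m - 1..n + m - 3}. \<Sum>\<tau>\<in>unshuffles (int k - (int m - 1)) (int m - 2). ?G k \<tau>)" .
    qed
  qed
qed

end
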